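(* Let $\mathcal{A}$ be a separable nonunital $C^*$-algebra and $K$ an essential ideal in $\mathcal{A}$. Let $S$ be a closed semiregular operator on $\mathcal{A}$ such that its restriction $S|_K$ to $K$ is regular. If $\mathcal{A}/K$ is abelian, then $S^{**}$ is regular.
   Context: A $C^*$-algebra $\mathcal{B}$ is regarded as a (right) Hilbert $\mathcal{B}$-module over itself with inner product $\langle a,b\rangle=a^*b$. An operator $T$ on $\mathcal{B}$ is a linear map with domain $D(T)\subseteq \mathcal{B}$ and values in $\mathcal{B}$; if $T$ is densely defined, its adjoint $T^*$ has domain $D(T^* )=\{a\in\mathcal{B}:\exists\, b\in\mathcal{B},\ \langle a,Tx\rangle=\langle b,x\rangle\ \forall x\in D(T)\}$ and $T^*a=b$. $T$ is closed (closable) if its graph is closed (the closure of its graph is a graph). $T$ is semiregular if (a) $D(T)$ is a dense right ideal of $\mathcal{B}$ (i.e. a dense submodule), (b) $T$ is closable, (c) $T^*$ is densely defined. $T$ is regular if it is closed and densely defined, $T^*$ is densely defined, and the range of $I+T^*T$ is dense in $\mathcal{B}$. The restriction $S|_K$ is the operator on $K$ (regarded as a Hilbert $K$-module) with domain $D(S)\cap K$, acting as $S$; for $S$ closed semiregular it takes values in $K$. *)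

theory Defs
  imports "HOL-Analysis.Analysis"
begin

section \<open>C*-algebras\<close>

text \<open>
  Not necessarily unital. The norm, the metric, completeness and submultiplicativity come from
  the library classes for real Banach algebras; complex scalars are required to extend real ones.
\<close>

class cstar_algebra = real_normed_algebra + banach +
  fixes scaleC :: "complex \<Rightarrow> 'a \<Rightarrow> 'a" (infixr "*\<^sub>C" 75)
    and star :: "'a \<Rightarrow> 'a"
  assumes scaleC_of_real: "complex_of_real r *\<^sub>C x = r *\<^sub>R x"
    and scaleC_add_right: "c *\<^sub>C (x + y) = c *\<^sub>C x + c *\<^sub>C y"
    and scaleC_add_left: "(c + d) *\<^sub>C x = c *\<^sub>C x + d *\<^sub>C x"
    and scaleC_scaleC: "c *\<^sub>C d *\<^sub>C x = (c * d) *\<^sub>C x"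
    and mult_scaleC_left: "(c *\<^sub>C x) * y = c *\<^sub>C (x * y)"
    and mult_scaleC_right: "x * (c *\<^sub>C y) = c *\<^sub>C (x * y)"
    and norm_scaleC: "norm (c *\<^sub>C x) = cmod c * norm x"
    and star_star: "star (star x) = x"
    and star_add: "star (x + y) = star x + star y"
    and star_scaleC: "star (c *\<^sub>C x) = cnj c *\<^sub>C star x"
    and star_mult: "star (x * y) = star y * star x"
    and cstar_identity: "norm (star x * x) = (norm x)\<^sup>2"

definition unital :: "'a::cstar_algebra itself \<Rightarrow> bool" where
  "unital _ \<longleftrightarrow> (\<exists>e::'a. \<forall>x. e * x = x \<and> x * e = x)"

definition closed_ideal :: "'a::cstar_algebra set \<Rightarrow> bool" where
  "closed_ideal K \<longleftrightarrow>
     closed K \<and> 0 \<in> K \<and>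
     (\<forall>x\<in>K. \<forall>y\<in>K. x + y \<in> K) \<and>
     (\<forall>c. \<forall>x\<in>K. c *\<^sub>C x \<in> K) \<and>
     (\<forall>a. \<forall>x\<in>K. a * x \<in> K \<and> x * a \<in> K)"

definition essential_ideal :: "'a::cstar_algebra set \<Rightarrow> bool" where
  "essential_ideal K \<longleftrightarrow>
     closed_ideal K \<and> (\<forall>J. closed_ideal J \<and> J \<noteq> {0} \<longrightarrow> K \<inter> J \<noteq> {0})"

text \<open>
  The quotient by an ideal as a set of additive cosets; for an ideal \<open>K\<close> the union below is the
  single coset of \<open>a * b\<close>, for any representatives \<open>a\<close> and \<open>b\<close>.
\<close>

definition coset :: "'a::cstar_algebra set \<Rightarrow> 'a \<Rightarrow> 'a set" where
  "coset K a = (+) a ` K"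

definition quotient_carrier :: "'a::cstar_algebra set \<Rightarrow> 'a set set" where
  "quotient_carrier K = range (coset K)"

definition quotient_mult :: "'a::cstar_algebra set \<Rightarrow> 'a set \<Rightarrow> 'a set \<Rightarrow> 'a set" where
  "quotient_mult K P Q = (\<Union>a\<in>P. \<Union>b\<in>Q. coset K (a * b))"

definition abelian_quotient :: "'a::cstar_algebra set \<Rightarrow> bool" where
  "abelian_quotient K \<longleftrightarrow>
     (\<forall>P\<in>quotient_carrier K. \<forall>Q\<in>quotient_carrier K. quotient_mult K P Q = quotient_mult K Q P)"


section \<open>Unbounded operators\<close>

text \<open>
  An operator is identified with its graph, so that its domain is \<^const>\<open>Domain\<close> of the graph.
  The parameter \<open>B\<close> is the C*-algebra on which the operator lives, regarded as a Hilbert module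
  over itself: all of the ambient algebra (\<^const>\<open>UNIV\<close>) or a closed ideal of it. As \<open>B\<close> is
  norm closed, closedness in \<open>B \<times> B\<close> is closedness in the ambient product space.
\<close>

definition hinner :: "'a::cstar_algebra \<Rightarrow> 'a \<Rightarrow> 'a" where
  "hinner a b = star a * b"

definition operator_on :: "'a::cstar_algebra set \<Rightarrow> ('a \<times> 'a) set \<Rightarrow> bool" where
  "operator_on B T \<longleftrightarrow>
     T \<subseteq> B \<times> B \<and> single_valued T \<and> (0, 0) \<in> T \<and>
     (\<forall>x y x' y'. (x, y) \<in> T \<and> (x', y') \<in> T \<longrightarrow> (x + x', y + y') \<in> T) \<and>
     (\<forall>c x y. (x, y) \<in> T \<longrightarrow> (c *\<^sub>C x, c *\<^sub>C y) \<in> T)"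

definition dense_in :: "'a::cstar_algebra set \<Rightarrow> 'a set \<Rightarrow> bool" where
  "dense_in B D \<longleftrightarrow> D \<subseteq> B \<and> B \<subseteq> closure D"

definition densely_defined :: "'a::cstar_algebra set \<Rightarrow> ('a \<times> 'a) set \<Rightarrow> bool" where
  "densely_defined B T \<longleftrightarrow> dense_in B (Domain T)"

text \<open>This relation is the graph of the adjoint operator when \<open>T\<close> is densely defined.\<close>

definition adjoint_on :: "'a::cstar_algebra set \<Rightarrow> ('a \<times> 'a) set \<Rightarrow> ('a \<times> 'a) set" where
  "adjoint_on B T =
     {(a, b). a \<in> B \<and> b \<in> B \<and> (\<forall>x y. (x, y) \<in> T \<longrightarrow> hinner a y = hinner b x)}"

definition closable :: "('a::cstar_algebra \<times> 'a) set \<Rightarrow> bool" where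
  "closable T \<longleftrightarrow> single_valued (closure T)"

definition semiregular_on :: "'a::cstar_algebra set \<Rightarrow> ('a \<times> 'a) set \<Rightarrow> bool" where
  "semiregular_on B T \<longleftrightarrow>
     operator_on B T \<and>
     densely_defined B T \<and>
     (\<forall>x\<in>Domain T. \<forall>b\<in>B. x * b \<in> Domain T) \<and>
     closable T \<and>
     densely_defined B (adjoint_on B T)"

text \<open>
  \<open>T O adjoint_on B T\<close> is the graph of the composite \<open>T* T\<close>, with its natural domain.
\<close>

definition regular_on :: "'a::cstar_algebra set \<Rightarrow> ('a \<times> 'a) set \<Rightarrow> bool" where
  "regular_on B T \<longleftrightarrow>
     operator_on B T \<and>
     closed T \<and>
     densely_defined B T \<and>
     densely_defined B (adjoint_on B T) \<and>
     dense_in B {x + z | x z. (x, z) \<in> T O adjoint_on B T}"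

definition restrict_op :: "('a::cstar_algebra \<times> 'a) set \<Rightarrow> 'a set \<Rightarrow> ('a \<times> 'a) set" where
  "restrict_op S K = {(x, y). (x, y) \<in> S \<and> x \<in> K}"

end

theory Submission
  imports Defs
begin

text \<open>
  Let \<open>I\<close> be the closure of the range of \<open>1 + S\<^sup>* S\<close>. Regularity of \<open>S|\<^sub>K\<close> gives \<open>K \<subseteq> I\<close>, and since
  commutators lie in \<open>K\<close>, the closed right ideal \<open>I\<close> is two-sided. For \<open>(w, p)\<close> in the graph of
  \<open>S\<close> and \<open>(v, q)\<close> in that of \<open>S\<^sup>*\<close>, the element \<open>S (w w\<^sup>* v) = p w\<^sup>* v\<close> differs from
  \<open>v p w\<^sup>* \<in> D(S\<^sup>*)\<close> only by some \<open>k \<in> K\<close>; splitting \<open>(0, k)\<close> along the graph of \<open>S|\<^sub>K\<close> and its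
  orthogonal complement removes \<open>k\<close> and shows \<open>w w\<^sup>* v + q p w\<^sup>* \<in> I\<close>. Modulo \<open>K\<close> this is
  \<open>(w\<^sup>* w + p\<^sup>* p) v\<close>, so \<open>I\<close> contains every \<open>(w\<^sup>* w + p\<^sup>* p) x\<close> and therefore \<open>w\<close>. As \<open>D(S)\<close> is
  dense, so is the range of \<open>1 + S\<^sup>* S\<close>, and the range of \<open>1 + S\<^sup>*\<^sup>*\<^sup>* S\<^sup>*\<^sup>*\<close> contains it.
\<close>

section \<open>Norm estimates in C*-algebras\<close>

lemma scaleC_one [simp]: "1 *\<^sub>C x = x"
  using scaleC_of_real [of 1 x] by simp

lemma scaleC_0_right [simp]: "c *\<^sub>C 0 = 0"
  using scaleC_add_right [of c 0 0] by simp

lemma scaleC_minus_right: "c *\<^sub>C (- x) = - (c *\<^sub>C x)"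
  using scaleC_add_right [of c x "- x"] by (simp add: eq_neg_iff_add_eq_0 add.commute)

lemma scaleC_diff_right: "c *\<^sub>C (x - y) = c *\<^sub>C x - c *\<^sub>C y"
  using scaleC_add_right [of c x "- y"] by (simp add: scaleC_minus_right)

lemma scaleC_minus_one [simp]: "(- 1) *\<^sub>C x = - x"
  using scaleC_of_real [of "- 1" x] by simp

lemma scaleC_minus_left: "(- c) *\<^sub>C x = - (c *\<^sub>C x)"
  using scaleC_scaleC [of "- 1" c x] by simp

lemma star_0 [simp]: "star 0 = 0"
  using star_add [of 0 0] by simp

lemma star_minus: "star (- x) = - star x"
  using star_add [of x "- x"] by (simp add: eq_neg_iff_add_eq_0 add.commute)

lemma star_diff: "star (x - y) = star x - star y"
  using star_add [of x "- y"] by (simp add: star_minus)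

lemma star_scaleR: "star (r *\<^sub>R x) = r *\<^sub>R star x"
  using star_scaleC [of "complex_of_real r" x] by (simp add: scaleC_of_real)

lemma norm_star [simp]: "norm (star x) = norm x"
proof -
  have le: "norm y \<le> norm (star y)" for y
  proof (cases "y = 0")
    case False
    have "norm y * norm y \<le> norm (star y) * norm y"
      using cstar_identity [of y] norm_mult_ineq [of "star y" y] by (simp add: power2_eq_square)
    with False show ?thesis by simp
  qed simp
  from le [of x] le [of "star x"] show ?thesis by (simp add: star_star)
qed

lemmas star_simps = star_add star_diff star_minus star_mult star_star star_scaleR star_scaleC
lemmas scaleC_simps = scaleC_add_right scaleC_diff_right scaleC_minus_right scaleC_minus_left
  mult_scaleC_left mult_scaleC_right scaleC_scaleC

lemma bounded_linear_star: "bounded_linear (star :: 'a::cstar_algebra \<Rightarrow> 'a)"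
  by (rule bounded_linear_intro [where K = 1]) (auto simp: star_simps)

lemmas continuous_on_star = bounded_linear.continuous_on [OF bounded_linear_star]

section \<open>Norm bounds for sums of squares\<close>

lemma norm_selfadjoint_square:
  fixes h :: "'a::cstar_algebra"
  assumes "star h = h"
  shows "norm (h * h) = (norm h)\<^sup>2"
  using cstar_identity [of h] assms by simp

lemma norm_mult_star:
  fixes a :: "'a::cstar_algebra"
  shows "norm (a * star a) = (norm a)\<^sup>2"
  using cstar_identity [of "star a"] by (simp add: star_star)

text \<open>The element \<open>1 - y\<close> is a square root of \<open>1 - h\<^sup>2\<close> that avoids mentioning a unit.\<close>

lemma sqrt_one_minus_square:
  fixes h :: "'a::cstar_algebra"
  assumes sa: "star h = h" and lt: "norm h < 1"
  obtains y where "star y = y" "h * y = y * h" "y + y = h * h + y * y"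
proof -
  \<comment> \<open>\<open>r\<close> is the smaller root of (norm h)^2 + r^2 = 2r, so
    \<open>f\<close> below maps the ball of radius \<open>r\<close> into itself and contracts it
    with constant \<open>r\<close> < 1.\<close>
  define r where "r = 1 - sqrt (1 - (norm h)\<^sup>2)"
  have n1: "(norm h)\<^sup>2 < 1" using lt by (simp add: power_less_one_iff)
  have r0: "0 \<le> r" "r < 1" using n1 by (auto simp: r_def)
  have rr: "(norm h)\<^sup>2 + r\<^sup>2 = 2 * r"
    using n1 by (simp add: r_def power2_diff)
  define f :: "'a \<Rightarrow> 'a" where "f y = (1/2) *\<^sub>R (h * h + y * y)" for y
  \<comment> \<open>Selfadjointness and commutation with \<open>h\<close> are closed conditions
    preserved by \<open>f\<close>, so the fixed point inherits them.\<close>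
  define X where "X = {y. norm y \<le> r \<and> star y = y \<and> h * y = y * h}"
  have "closed X" unfolding X_def
    by (intro closed_Collect_conj closed_Collect_le closed_Collect_eq continuous_intros
        continuous_on_star)
  then have cX: "complete X" by (simp add: complete_eq_closed)
  have ne: "X \<noteq> {}" using r0 by (auto simp: X_def intro!: exI [of _ 0])
  have fX: "f ` X \<subseteq> X"
  proof
    fix z assume "z \<in> f ` X"
    then obtain y where y: "norm y \<le> r" "star y = y" "h * y = y * h" "z = f y"
      by (auto simp: X_def)
    have "norm (h * h + y * y) \<le> (norm h)\<^sup>2 + r\<^sup>2"
      using y(1) by (intro norm_triangle_mono)
        (simp_all add: norm_selfadjoint_square sa y(2) power_mono)
    then have "norm (f y) \<le> r" using rr by (simp add: f_def)
    moreover have "h * (y * y) = y * y * h" using y(3) by (metis mult.assoc)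
    ultimately show "z \<in> X"
      using y sa by (simp add: X_def f_def star_simps algebra_simps)
  qed
  have lip: "dist (f x) (f y) \<le> r * dist x y" if "x \<in> X" "y \<in> X" for x y
  proof -
    have "f x - f y = (1/2) *\<^sub>R (x * (x - y) + (x - y) * y)"
      by (simp add: f_def algebra_simps)
    moreover have "norm (x * (x - y) + (x - y) * y) \<le> r * norm (x - y) + norm (x - y) * r"
      using that by (intro norm_triangle_mono order.trans [OF norm_mult_ineq] mult_mono)
        (auto simp: X_def r0)
    ultimately show ?thesis by (simp add: dist_norm)
  qed
  obtain y where "y \<in> X" "f y = y"
    using Banach_fix [OF cX ne r0 fX] lip by blast
  moreover from this have "2 *\<^sub>R y = 2 *\<^sub>R f y" by simp
  then have "y + y = h * h + y * y" by (simp add: f_def scaleR_2)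
  ultimately show thesis by (intro that) (auto simp: X_def)
qed

text \<open>
  With \<open>y\<close> as above \<open>U = h + \<i>(1 - y)\<close> and its adjoint \<open>V\<close> are isometric, and
  \<open>(U\<^sup>2 + V\<^sup>2) / 2 = 2h\<^sup>2 - 1\<close>.
\<close>

lemma norm_minus_double_square_le_unit:
  fixes h x :: "'a::cstar_algebra"
  assumes sa: "star h = h" and lt: "norm h < 1"
  shows "norm (x - 2 *\<^sub>R (h * h * x)) \<le> norm x"
proof -
  obtain y where y: "star y = y" "h * y = y * h" "y + y = h * h + y * y"
    using sqrt_one_minus_square [OF sa lt] .
  define U where "U c x = h * x + c *\<^sub>C (x - y * x)" for c x
  have hyl: "h * (y * z) = y * (h * z)" for z
    using y(2) by (metis mult.assoc)
  have yyl: "y * (y * z) = y * z + y * z - h * (h * z)" for z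
  proof -
    have "y * y = y + y - h * h" using y(3) by simp
    then have "y * y * z = (y + y - h * h) * z" by simp
    then show ?thesis by (simp add: algebra_simps)
  qed
  have iso: "norm (U c x) = norm x" if c: "c = \<i> \<or> c = - \<i>" for c x
  proof -
    \<comment> \<open>As \<open>c\<close> is purely imaginary and \<open>h\<close> commutes with
      \<open>y\<close>, the cross terms cancel; h^2 + (1 - y)^2 = 1 does the rest.\<close>
    have "star (U c x) * U c x = star x * x"
      using c by (elim disjE)
        (simp_all add: U_def star_simps sa y(1) scaleC_simps algebra_simps hyl yyl)
    then have "(norm (U c x))\<^sup>2 = (norm x)\<^sup>2"
      using cstar_identity by metis
    then show ?thesis by simp
  qed
  have "U \<i> (U \<i> x) + U (- \<i>) (U (- \<i>) x) = - (2 *\<^sub>R (x - 2 *\<^sub>R (h * h * x)))"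
    by (simp add: U_def scaleC_simps algebra_simps hyl yyl scaleR_2)
  then have "2 * norm (x - 2 *\<^sub>R (h * h * x)) = norm (U \<i> (U \<i> x) + U (- \<i>) (U (- \<i>) x))"
    by simp
  also have "\<dots> \<le> norm x + norm x"
    by (intro norm_triangle_mono) (auto simp: iso)
  finally show ?thesis by simp
qed

text \<open>Dividing \<open>h\<close> by sqrt M reduces to M = 1. Spectrally, h^2 lies between 0 and
  M, so M - 2h^2 lies between -M and M; letting it act on \<open>x\<close> avoids a unit.\<close>

lemma norm_minus_double_square_le:
  fixes h x :: "'a::cstar_algebra"
  assumes sa: "star h = h" and lt: "(norm h)\<^sup>2 < M"
  shows "norm (M *\<^sub>R x - 2 *\<^sub>R (h * h * x)) \<le> M * norm x"
proof -
  have M: "M > 0" using le_less_trans [OF zero_le_power2 lt] .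
  define k where "k = (1 / sqrt M) *\<^sub>R h"
  have "norm h < sqrt M" using lt M by (simp add: real_less_rsqrt)
  then have "norm k < 1" using M by (simp add: k_def divide_less_eq)
  moreover have "star k = k" by (simp add: k_def star_simps sa)
  ultimately have "norm (x - 2 *\<^sub>R (k * k * x)) \<le> norm x"
    by (rule norm_minus_double_square_le_unit [rotated])
  moreover have "M *\<^sub>R x - 2 *\<^sub>R (h * h * x) = M *\<^sub>R (x - 2 *\<^sub>R (k * k * x))"
    using M by (simp add: k_def scaleR_diff_right)
  ultimately show ?thesis using M by simp
qed

text \<open>
  For the largest square \<open>v\<close>, with \<open>M\<close> slightly above \<open>norm v\<close>, put \<open>T = 3M\<close> and \<open>V = 2v\<close>.
  If the sum is small, then \<open>T + V\<close> is nearly \<open>T\<close> minus twice the other three squares, so both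
  \<open>T + V\<close> and \<open>T - V\<close> have norm close to at most \<open>T\<close>; this contradicts
  \<open>4TV = (T + V)\<^sup>2 - (T - V)\<^sup>2\<close>.
\<close>

lemma norm_le_sum_four_squares:
  fixes z :: "nat \<Rightarrow> 'a::cstar_algebra"
  assumes sa: "\<And>i. i < 4 \<Longrightarrow> star (z i) = z i" and j: "j < 4"
  shows "(norm (z j))\<^sup>2 \<le> 4 * norm (\<Sum>i<4. z i * z i)"
proof -
  define s where "s = (\<Sum>i<4. z i * z i)"
  have "Max ((\<lambda>i. norm (z i)) ` {..<4}) \<in> (\<lambda>i. norm (z i)) ` {..<4}"
    by (rule Max_in) (simp_all add: lessThan_empty_iff)
  then obtain m where m: "m < 4" and m_eq: "Max ((\<lambda>i. norm (z i)) ` {..<4}) = norm (z m)"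
    by auto
  have max: "norm (z i) \<le> norm (z m)" if "i < 4" for i
    unfolding m_eq [symmetric] using that by (intro Max_ge) auto
  define v where "v = z m * z m"
  have vsa: "star v = v" by (simp add: v_def star_simps sa m)
  define n where "n = norm v"
  have nz: "n = (norm (z m))\<^sup>2" by (simp add: n_def v_def norm_selfadjoint_square sa m)
  have "n \<le> 4 * norm s"
  proof (cases "n = 0")
    case False
    then have n0: "n > 0" by (simp add: n_def)
    \<comment> \<open>The bound for each square needs a strict inequality. With the factor 10/9,
      24Mn = 21.6 M^2 still exceeds the 18 M^2 obtained for s = 0, with enough room for norm s up to
      M/4.\<close>
    define M where "M = n * (10 / 9)"
    have zM: "(norm (z i))\<^sup>2 < M" if "i < 4" for i
    proof -
      have "(norm (z i))\<^sup>2 \<le> n" using max [OF that] by (simp add: nz power_mono)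
      then show ?thesis using n0 by (simp add: M_def)
    qed
    note le = norm_minus_double_square_le [OF sa zM]
    have plus: "norm ((3 * M) *\<^sub>R x + 2 *\<^sub>R (v * x)) \<le> (3 * M + 2 * norm s) * norm x" for x
    proof -
      let ?R = "{..<4} - {m}"
      have "s = v + (\<Sum>i\<in>?R. z i * z i)"
        unfolding s_def v_def using m by (subst sum.remove [of _ m]) auto
      moreover have card: "card ?R = 3" using m by simp
      ultimately have "(3 * M) *\<^sub>R x + 2 *\<^sub>R (v * x)
          = (\<Sum>i\<in>?R. M *\<^sub>R x - 2 *\<^sub>R (z i * z i * x)) + 2 *\<^sub>R (s * x)"
        by (simp add: sum_subtractf algebra_simps scaleR_sum_right sum_distrib_right
            sum_constant_scaleR)
      also have "norm \<dots> \<le> (\<Sum>i\<in>?R. M * norm x) + 2 * (norm s * norm x)"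
        by (intro norm_triangle_mono sum_norm_le) (auto simp: le norm_mult_ineq)
      also have "\<dots> = (3 * M + 2 * norm s) * norm x"
        using card by (simp add: algebra_simps)
      finally show ?thesis .
    qed
    have minus: "norm ((3 * M) *\<^sub>R x - 2 *\<^sub>R (v * x)) \<le> 3 * M * norm x" for x
    proof -
      have "(3 * M) *\<^sub>R x - 2 *\<^sub>R (v * x) = (2 * M) *\<^sub>R x + (M *\<^sub>R x - 2 *\<^sub>R (v * x))"
        by (simp flip: scaleR_add_left)
      also have "norm \<dots> \<le> 2 * M * norm x + M * norm x"
        using le [OF m m, of x] n0 by (intro norm_triangle_mono) (auto simp: v_def M_def)
      finally show ?thesis by simp
    qed
    define P where "P x = (3 * M) *\<^sub>R x + 2 *\<^sub>R (v * x)" for x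
    define Q where "Q x = (3 * M) *\<^sub>R x - 2 *\<^sub>R (v * x)" for x
    have c0: "0 \<le> 3 * M + 2 * norm s" "0 \<le> 3 * M" using n0 by (simp_all add: M_def)
    have "(24 * M) *\<^sub>R (v * v) = P (P v) - Q (Q v)"
      by (simp add: P_def Q_def algebra_simps flip: scaleR_add_left)
    then have "24 * M * norm (v * v) = norm (P (P v) - Q (Q v))"
      using n0 by (metis M_def abs_of_pos norm_scaleR mult_pos_pos divide_pos_pos zero_less_numeral)
    also have "\<dots> \<le> (3 * M + 2 * norm s) * ((3 * M + 2 * norm s) * norm v)
        + 3 * M * (3 * M * norm v)"
      unfolding P_def Q_def
      by (intro order.trans [OF norm_triangle_ineq4] add_mono
          order.trans [OF plus mult_left_mono [OF plus]]
          order.trans [OF minus mult_left_mono [OF minus]] c0)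
    finally have "24 * M * (n * n) \<le> ((3 * M + 2 * norm s)\<^sup>2 + 9 * M\<^sup>2) * n"
      by (simp add: n_def norm_selfadjoint_square [OF vsa] power2_eq_square algebra_simps)
    then have "24 * M * n \<le> (3 * M + 2 * norm s)\<^sup>2 + 9 * M\<^sup>2"
      using n0 by (simp add: mult.assoc [symmetric])
    then have main: "(36 / 10) * M\<^sup>2 \<le> 12 * M * norm s + 4 * (norm s)\<^sup>2"
      by (simp add: M_def power2_eq_square algebra_simps)
    show ?thesis
    proof (rule ccontr)
      assume "\<not> n \<le> 4 * norm s"
      then have "norm s \<le> M / 4" using n0 by (simp add: M_def)
      then have "12 * M * norm s \<le> 12 * M * (M / 4)" "(norm s)\<^sup>2 \<le> (M / 4)\<^sup>2"
        using c0 by (intro mult_left_mono power_mono; simp)+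
      with main have "(36 / 10) * M\<^sup>2 \<le> (325 / 100) * M\<^sup>2"
        by (simp add: power2_eq_square)
      then show False using n0 by (simp add: M_def)
    qed
  qed simp
  moreover have "(norm (z j))\<^sup>2 \<le> n" using max [OF j] by (simp add: nz power_mono)
  ultimately show ?thesis by (simp add: s_def)
qed

text \<open>
  With \<open>y = b a\<^sup>*\<close> and \<open>y\<^sup>* y + y y\<^sup>* = x\<^sub>1\<^sup>2 + x\<^sub>2\<^sup>2\<close> for selfadjoint \<open>x\<^sub>1\<close>, \<open>x\<^sub>2\<close>, the equation
  \<open>y\<^sup>* y + y y\<^sup>* + (a a\<^sup>*)\<^sup>2 + (b b\<^sup>*)\<^sup>2 = a h a\<^sup>* + b h b\<^sup>*\<close> with \<open>h = a\<^sup>* a + b\<^sup>* b\<close> reduces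
  the estimate to four selfadjoint squares, so no positivity of \<open>a\<^sup>* a\<close> is required.
\<close>

lemma norm_le_sum_star_mult:
  fixes a b :: "'a::cstar_algebra"
  shows "(norm a)\<^sup>2 \<le> 8 * norm (star a * a + star b * b)"
    and "(norm b)\<^sup>2 \<le> 8 * norm (star a * a + star b * b)"
proof -
  define h where "h = star a * a + star b * b"
  define y where "y = b * star a"
  \<comment> \<open>\<open>x1\<close> and \<open>x2\<close> are the real and imaginary parts of
    \<open>y\<close>, scaled so that their squares add up to exactly
    \<open>star y * y + y * star y\<close>.\<close>
  define r where "r = 1 / sqrt 2"
  have rr: "r * r = 1 / 2" by (simp add: r_def)
  define x1 where "x1 = r *\<^sub>R (y + star y)"
  define x2 where "x2 = r *\<^sub>R (\<i> *\<^sub>C (star y - y))"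
  define z where "z i = (if i = 0 then a * star a else if i = 1 then b * star b
    else if i = 2 then x1 else x2)" for i :: nat
  have sa: "star (z i) = z i" for i
    by (simp add: z_def x1_def x2_def star_simps scaleC_simps add.commute)
  have sq1: "x1 * x1 = (1/2) *\<^sub>R ((y + star y) * (y + star y))"
    by (simp add: x1_def rr)
  have sq2: "x2 * x2 = (1/2) *\<^sub>R (- ((star y - y) * (star y - y)))"
  proof -
    have "(\<i> *\<^sub>C d) * (\<i> *\<^sub>C d) = - (d * d)" for d :: 'a
      by (simp add: mult_scaleC_left mult_scaleC_right scaleC_scaleC)
    then show ?thesis by (simp add: x2_def rr)
  qed
  have "x1 * x1 + x2 * x2
      = (1/2) *\<^sub>R ((y + star y) * (y + star y) - (star y - y) * (star y - y))"
    unfolding sq1 sq2 by (simp add: scaleR_diff_right)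
  also have "\<dots> = (1/2) *\<^sub>R (2 *\<^sub>R (star y * y + y * star y))"
    by (simp add: algebra_simps scaleR_2)
  finally have x12: "x1 * x1 + x2 * x2 = star y * y + y * star y" by simp
  have "(\<Sum>i<4. z i * z i) = a * star a * (a * star a) + b * star b * (b * star b)
      + (x1 * x1 + x2 * x2)"
    by (simp add: z_def eval_nat_numeral)
  also have "\<dots> = a * h * star a + b * h * star b"
    by (simp add: x12 y_def h_def star_simps algebra_simps)
  finally have sum: "(\<Sum>i<4. z i * z i) = a * h * star a + b * h * star b" .
  have sand: "norm (c * h * star c) \<le> norm h * (norm c)\<^sup>2" for c :: 'a
  proof -
    have "norm (c * h * star c) \<le> norm c * norm h * norm (star c)"
      by (meson mult_right_mono norm_ge_zero norm_mult_ineq order.trans)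
    then show ?thesis by (simp add: power2_eq_square mult_ac)
  qed
  \<comment> \<open>The sum of the four squares has norm at most 2 (norm h) m^2, and two of them are
    the squares of \<open>a * star a\<close> and \<open>b * star b\<close>. This yields m^4 <= 8
    (norm h) m^2, where m^2 cancels.\<close>
  define m where "m = max (norm a) (norm b)"
  have am: "norm a \<le> m" "norm b \<le> m" by (auto simp: m_def)
  have sandm: "norm (c * h * star c) \<le> norm h * m\<^sup>2" if "norm c \<le> m" for c :: 'a
    by (rule order.trans [OF sand]) (intro mult_left_mono power_mono that norm_ge_zero)
  have le: "norm (\<Sum>i<4. z i * z i) \<le> 2 * norm h * m\<^sup>2"
    unfolding sum using norm_triangle_mono [OF sandm [OF am(1)] sandm [OF am(2)]] by simp
  have zle: "(norm (z i))\<^sup>2 \<le> 8 * norm h * m\<^sup>2" if "i < 4" for i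
    using norm_le_sum_four_squares [of z i, OF sa that] le by linarith
  have "norm (z 0) = (norm a)\<^sup>2" "norm (z 1) = (norm b)\<^sup>2"
    by (simp_all add: z_def norm_mult_star)
  with zle [of 0] zle [of 1]
  have "((norm a)\<^sup>2)\<^sup>2 \<le> 8 * norm h * m\<^sup>2" "((norm b)\<^sup>2)\<^sup>2 \<le> 8 * norm h * m\<^sup>2"
    by simp_all
  then have "m\<^sup>2 * m\<^sup>2 \<le> 8 * norm h * m\<^sup>2"
    by (auto simp: m_def max_def power2_eq_square)
  then have "m\<^sup>2 \<le> 8 * norm h"
    by (cases "m = 0") (simp, metis mult_le_cancel_right zero_less_power2 not_less_iff_gr_or_eq)
  moreover have "(norm a)\<^sup>2 \<le> m\<^sup>2" "(norm b)\<^sup>2 \<le> m\<^sup>2"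
    using am by (auto intro: power_mono)
  ultimately show "(norm a)\<^sup>2 \<le> 8 * norm (star a * a + star b * b)"
    and "(norm b)\<^sup>2 \<le> 8 * norm (star a * a + star b * b)"
    by (auto simp: h_def)
qed

section \<open>Approximate units and closed left ideals\<close>

text \<open>The element \<open>e\<close> is \<open>h\<^sup>2 (h\<^sup>2 + l\<^sup>2)\<^sup>-\<^sup>1\<close>; it exists inside the ideal by contraction.\<close>

lemma approximate_unit_in_ideal:
  fixes h :: "'a::cstar_algebra"
  assumes sa: "star h = h" and l: "l > 0"
    and I: "closed I" "subspace I" and hI: "\<And>x. h * x \<in> I"
  obtains e where "e \<in> I" "norm e \<le> 8" "norm (h - h * e) \<le> 9 * l"
proof -
  define M where "M = (norm h)\<^sup>2 + 1"
  have M: "(norm h)\<^sup>2 < M" "0 < M" by (simp_all add: M_def add_nonneg_pos)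
  define d where "d = 1 / (l\<^sup>2 + M)"
  have "l\<^sup>2 + M > l\<^sup>2" using M by simp
  then have d0: "0 < d" "d * l\<^sup>2 < 1" and dl: "d * l\<^sup>2 + d * M = 1"
    using M by (auto simp: d_def divide_simps add_pos_pos) (use zero_le_power2 [of l] in linarith)+
  \<comment> \<open>A relaxation step for the equation (h^2 + l^2) e = h^2. By the choice of
    \<open>d\<close>, its linear part is (d/2)(M - 2h^2) + dM/2, of norm at most dM = 1 - d
    l^2.\<close>
  define f where "f e = e - d *\<^sub>R (h * h * e + l\<^sup>2 *\<^sub>R e - h * h)" for e
  have "\<exists>!e\<in>I. f e = e"
  proof (rule Banach_fix [where c = "1 - d * l\<^sup>2"])
    show "complete I" using I by (simp add: complete_eq_closed)
    show "I \<noteq> {}" using subspace_0 I by auto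
    show "f ` I \<subseteq> I"
      unfolding f_def using I(2) hI
      by (auto simp: mult.assoc intro!: subspace_diff subspace_add subspace_scale)
    show "dist (f x) (f y) \<le> (1 - d * l\<^sup>2) * dist x y" for x y
    proof -
      define u where "u = x - y"
      have "f x - f y = (1 - d * l\<^sup>2) *\<^sub>R u - d *\<^sub>R (h * h * u)"
        by (simp add: f_def u_def algebra_simps)
      also have "1 - d * l\<^sup>2 = d * M / 2 + d * M / 2" using dl by linarith
      also have "(d * M / 2 + d * M / 2) *\<^sub>R u - d *\<^sub>R (h * h * u)
          = (d / 2) *\<^sub>R (M *\<^sub>R u - 2 *\<^sub>R (h * h * u)) + (d * M / 2) *\<^sub>R u"
        by (simp only: scaleR_add_left) (simp add: scaleR_diff_right)
      finally have "norm (f x - f y) \<le> (d / 2) * (M * norm u) + (d * M / 2) * norm u"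
        using mult_left_mono [OF norm_minus_double_square_le [OF sa M(1), of u], of "d / 2"] d0 M
        by (simp only:) (rule norm_triangle_mono, simp_all)
      also have "\<dots> = (d * M) * norm u" by simp
      also have "d * M = 1 - d * l\<^sup>2" using dl by linarith
      finally show ?thesis by (simp add: dist_norm u_def)
    qed
  qed (use d0 l in auto)
  then obtain e where eI: "e \<in> I" and fe: "f e = e" by blast
  define g where "g = h - h * e"
  have "h * h * e + l\<^sup>2 *\<^sub>R e - h * h = 0" using fe d0 by (simp add: f_def)
  then have hg: "h * g = l\<^sup>2 *\<^sub>R e" by (simp add: g_def algebra_simps)
  have gg: "star g * g = l\<^sup>2 *\<^sub>R (e - star e * e)"
  proof -
    have "star g * g = h * g - star e * (h * g)"
      by (simp add: g_def star_simps sa algebra_simps)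
    then show ?thesis by (simp add: hg algebra_simps)
  qed
  \<comment> \<open>Scaling by 1/l turns the formula for \<open>star g * g\<close> into
    \<open>star k * k = e - star e * e\<close>. The sum estimate then gives (norm e)^2 <= 8 norm e,
    hence the bound 8.\<close>
  define k where "k = (1 / l) *\<^sub>R g"
  have "star e * e + star k * k = e"
    using l by (simp add: k_def star_simps gg power2_eq_square)
  with norm_le_sum_star_mult(1) [of e k] have "(norm e)\<^sup>2 \<le> 8 * norm e" by simp
  then have e8: "norm e \<le> 8" by (cases "e = 0") (auto simp: power2_eq_square)
  have "norm (e - star e * e) \<le> norm e + (norm e)\<^sup>2"
    using norm_triangle_ineq4 [of e "star e * e"] by (simp add: cstar_identity)
  also have "\<dots> \<le> 8 + 8\<^sup>2" using e8 by (intro add_mono power_mono) auto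
  finally have "norm (e - star e * e) \<le> 9\<^sup>2" by simp
  then have "l\<^sup>2 * norm (e - star e * e) \<le> l\<^sup>2 * 9\<^sup>2" by (intro mult_left_mono) auto
  moreover have "(norm g)\<^sup>2 = l\<^sup>2 * norm (e - star e * e)"
    using cstar_identity [of g] gg by simp
  ultimately have "(norm g)\<^sup>2 \<le> (9 * l)\<^sup>2" by (simp add: power_mult_distrib)
  then have "norm g \<le> 9 * l" using l by (auto intro: power2_le_imp_le)
  with that eI e8 show thesis by (simp add: g_def)
qed

text \<open>For an approximate unit \<open>e\<close> of \<open>h\<close> in \<open>I\<close>, the
  sum estimate controls \<open>w - w * e\<close> by \<open>h - h * e\<close>. Since
  \<open>w * e\<close> lies in \<open>I\<close>, so does the limit \<open>w\<close>.\<close>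

lemma mem_ideal_if_sum_star_mult:
  fixes w p :: "'a::cstar_algebra"
  assumes I: "closed I" "subspace I" and left: "\<And>a x. x \<in> I \<Longrightarrow> a * x \<in> I"
    and hI: "\<And>x. (star w * w + star p * p) * x \<in> I"
  shows "w \<in> I"
proof -
  define h where "h = star w * w + star p * p"
  have sa: "star h = h" by (simp add: h_def star_simps)
  have "\<exists>x\<in>I. dist x w < \<epsilon>" if "\<epsilon> > 0" for \<epsilon>
  proof -
    \<comment> \<open>The error below is at most 8 * 9 * 9 * l = 648 l, which must stay under
      \<epsilon>^2.\<close>
    define l where "l = \<epsilon>\<^sup>2 / 1000"
    have l: "l > 0" using that by (simp add: l_def)
    obtain e where e: "e \<in> I" "norm e \<le> 8" "norm (h - h * e) \<le> 9 * l"
      using approximate_unit_in_ideal [OF sa l I] hI h_def by blast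
    define g where "g = h - h * e"
    have "star (w - w * e) * (w - w * e) + star (p - p * e) * (p - p * e) = g - star e * g"
      by (simp add: g_def h_def star_simps algebra_simps)
    then have "(norm (w - w * e))\<^sup>2 \<le> 8 * norm (g - star e * g)"
      using norm_le_sum_star_mult(1) [of "w - w * e" "p - p * e"] by simp
    also have "norm (g - star e * g) \<le> norm g + 8 * norm g"
      using e(2) norm_mult_ineq [of "star e" g] mult_right_mono [OF e(2), of "norm g"]
        norm_triangle_ineq4 [of g "star e * g"] by simp
    also have "8 * (norm g + 8 * norm g) \<le> 8 * (9 * (9 * l))"
      using e(3) by (simp add: g_def)
    also have "\<dots> < \<epsilon>\<^sup>2" using that by (simp add: l_def)
    finally have "norm (w - w * e) < \<epsilon>"
      using that by (simp add: power_less_imp_less_base)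
    with left [OF e(1)] show ?thesis by (auto simp: dist_norm norm_minus_commute)
  qed
  with I(1) show ?thesis using closure_approachable closure_closed by metis
qed

section \<open>Unbounded operators\<close>

lemma mult_eq_0_if_closure:
  fixes y :: "'a::cstar_algebra"
  assumes dense: "closure D = UNIV" and 0: "\<And>a. a \<in> D \<Longrightarrow> star a * y = 0"
  shows "y = 0"
proof -
  have "(\<lambda>a. star a * y) ` closure D \<subseteq> {0}"
    by (rule image_closure_subset)
      (use 0 in \<open>auto intro!: continuous_intros continuous_on_star\<close>)
  then have "star y * y = 0" using dense by auto
  then show ?thesis using cstar_identity [of y] by simp
qed

lemma adjoint_onI:
  assumes "\<And>x y. (x, y) \<in> T \<Longrightarrow> star a * y = star b * x"
  shows "(a, b) \<in> adjoint_on UNIV T"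
  using assms by (auto simp: adjoint_on_def hinner_def)

lemma adjoint_onD: "(a, b) \<in> adjoint_on B T \<Longrightarrow> (x, y) \<in> T \<Longrightarrow> star a * y = star b * x"
  by (auto simp: adjoint_on_def hinner_def)

lemma closed_adjoint_on: "closed (adjoint_on UNIV T)"
proof -
  have "adjoint_on UNIV T = (\<Inter>(x, y)\<in>T. {c. star (fst c) * y = star (snd c) * x})"
    by (auto simp: adjoint_on_def hinner_def)
  also have "closed \<dots>"
    by (auto intro!: closed_Collect_eq continuous_intros continuous_on_star)
  finally show ?thesis .
qed

lemma adjoint_on_closed_under:
  shows adjoint_on_add: "(a, b) \<in> adjoint_on UNIV T \<Longrightarrow> (c, d) \<in> adjoint_on UNIV T
      \<Longrightarrow> (a + c, b + d) \<in> adjoint_on UNIV T"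
    and adjoint_on_diff: "(a, b) \<in> adjoint_on UNIV T \<Longrightarrow> (c, d) \<in> adjoint_on UNIV T
      \<Longrightarrow> (a - c, b - d) \<in> adjoint_on UNIV T"
    and adjoint_on_scaleC: "(a, b) \<in> adjoint_on UNIV T \<Longrightarrow> (k *\<^sub>C a, k *\<^sub>C b) \<in> adjoint_on UNIV T"
    and adjoint_on_mult_right: "(a, b) \<in> adjoint_on UNIV T \<Longrightarrow> (a * m, b * m) \<in> adjoint_on UNIV T"
  by (auto simp: adjoint_on_def hinner_def star_simps algebra_simps scaleC_simps)

lemma operator_on_adjoint_on:
  assumes "closure (Domain T) = UNIV"
  shows "operator_on UNIV (adjoint_on UNIV T)"
  unfolding operator_on_def
proof (intro conjI allI impI)
  show "single_valued (adjoint_on UNIV T)"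
  proof (rule single_valuedI)
    fix a b c assume bc: "(a, b) \<in> adjoint_on UNIV T" "(a, c) \<in> adjoint_on UNIV T"
    have "star x * (b - c) = 0" if x: "x \<in> Domain T" for x
    proof -
      obtain y where "(x, y) \<in> T" using x by auto
      then have "star (b - c) * x = 0"
        using bc [THEN adjoint_onD] by (simp add: star_simps algebra_simps)
      then have "star (star (b - c) * x) = 0" by simp
      then show ?thesis by (simp add: star_simps)
    qed
    then show "b = c" using mult_eq_0_if_closure [OF assms] by fastforce
  qed
qed (auto intro: adjoint_on_add adjoint_on_scaleC adjoint_onI)

lemma subset_adjoint_adjoint: "T \<subseteq> adjoint_on UNIV (adjoint_on UNIV T)"
proof
  fix c assume "c \<in> T"
  moreover obtain x y where "c = (x, y)" by fastforce
  moreover have "star x * b = star y * a" if "(a, b) \<in> adjoint_on UNIV T" "(x, y) \<in> T" for a b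
  proof -
    have "star (star a * y) = star (star b * x)" using adjoint_onD [OF that] by simp
    then show ?thesis by (simp add: star_simps)
  qed
  ultimately show "c \<in> adjoint_on UNIV (adjoint_on UNIV T)" by (auto intro!: adjoint_onI)
qed

section \<open>Essential ideals and abelian quotients\<close>

text \<open>The left annihilator \<open>J\<close> of \<open>K\<close> is a closed two-sided ideal.
  An \<open>x\<close> in both satisfies \<open>x * star x * x = 0\<close>, hence x = 0, so
  essentiality forces \<open>J\<close> to vanish.\<close>

lemma essential_ideal_annihilator:
  fixes K :: "'a::cstar_algebra set"
  assumes K: "essential_ideal K" and c: "\<And>k. k \<in> K \<Longrightarrow> c * k = 0"
  shows "c = 0"
proof -
  define J where "J = {c. \<forall>k\<in>K. c * k = 0}"
  have Kid: "closed_ideal K" using K by (simp add: essential_ideal_def)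
  have "J = (\<Inter>k\<in>K. {c. c * k = 0})" by (auto simp: J_def)
  also have "closed \<dots>" by (auto intro!: closed_Collect_eq continuous_intros)
  finally have "closed_ideal J"
    using Kid by (auto simp: closed_ideal_def J_def algebra_simps mult_scaleC_left mult.assoc)
  moreover have "K \<inter> J = {0}"
  proof -
    have "x = 0" if x: "x \<in> K" "x \<in> J" for x
    proof -
      have "x * (star x * x) = 0" using x Kid by (auto simp: J_def closed_ideal_def)
      then have "star (star x * x) * (star x * x) = 0"
        by (simp add: star_simps mult.assoc)
      then show ?thesis
        using cstar_identity [of "star x * x"] cstar_identity [of x] by simp
    qed
    moreover have "0 \<in> K" using Kid by (simp add: closed_ideal_def)
    ultimately show ?thesis by (auto simp: J_def)
  qed
  ultimately have "J = {0}" using K by (auto simp: essential_ideal_def)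
  with c show ?thesis by (auto simp: J_def)
qed

lemma closed_ideal_diff:
  assumes "closed_ideal K" "x \<in> K" "y \<in> K"
  shows "x - y \<in> K"
proof -
  have "(- 1) *\<^sub>C y \<in> K" using assms by (simp add: closed_ideal_def del: scaleC_minus_one)
  then have "- y \<in> K" by simp
  then have "x + - y \<in> K" using assms unfolding closed_ideal_def by blast
  then show ?thesis by simp
qed

lemma abelian_quotient_commutator:
  fixes K :: "'a::cstar_algebra set"
  assumes K: "closed_ideal K" and ab: "abelian_quotient K"
  shows "a * b - b * a \<in> K"
proof -
  have K0: "0 \<in> K" and add: "\<And>x y. x \<in> K \<Longrightarrow> y \<in> K \<Longrightarrow> x + y \<in> K"
    and id: "\<And>a x. x \<in> K \<Longrightarrow> a * x \<in> K \<and> x * a \<in> K"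
    using K by (auto simp: closed_ideal_def)
  have mem: "x \<in> coset K x" for x using K0 by (auto simp: coset_def intro: image_eqI [of _ _ 0])
  have "a * b \<in> quotient_mult K (coset K a) (coset K b)"
    unfolding quotient_mult_def using mem by blast
  also have "\<dots> = quotient_mult K (coset K b) (coset K a)"
    using ab by (auto simp: abelian_quotient_def quotient_carrier_def)
  finally obtain k1 k2 k3 where k: "k1 \<in> K" "k2 \<in> K" "k3 \<in> K"
    and eq: "a * b = (b + k1) * (a + k2) + k3"
    by (auto simp: quotient_mult_def coset_def)
  have "a * b - b * a = b * k2 + k1 * a + k1 * k2 + k3" using eq by (simp add: algebra_simps)
  then show ?thesis using add id k by simp
qed

section \<open>Orthogonal decomposition along the graph\<close>

lemma operator_on_diff:
  assumes "operator_on B T" "(x, y) \<in> T" "(x', y') \<in> T"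
  shows "(x - x', y - y') \<in> T"
proof -
  have "((- 1) *\<^sub>C x', (- 1) *\<^sub>C y') \<in> T"
    using assms unfolding operator_on_def by blast
  then have "(x + - x', y + - y') \<in> T"
    using assms unfolding operator_on_def by (metis scaleC_minus_one)
  then show ?thesis by simp
qed

lemma operator_on_scaleR:
  assumes "operator_on B T" "(x, y) \<in> T"
  shows "(r *\<^sub>R x, r *\<^sub>R y) \<in> T"
  using assms unfolding operator_on_def by (metis scaleC_of_real)

lemma adjoint_on_eq: "adjoint_on K T = (K \<times> K) \<inter> adjoint_on UNIV T"
  by (auto simp: adjoint_on_def)

text \<open>This makes the splitting of (e, k) into (t, r) in the graph and (e - t, k - r) in its
  complement Lipschitz. Pairing with (t, r) bounds a quadratic expression in (t, r) by a linear
  one.\<close>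

lemma graph_norm_bound:
  fixes t r k e :: "'a::cstar_algebra"
  assumes T: "(t, r) \<in> T" and adj: "(k - r, t - e) \<in> adjoint_on UNIV T"
  shows "norm t \<le> 8 * (norm k + norm e)" and "norm r \<le> 8 * (norm k + norm e)"
proof -
  define m where "m = max (norm t) (norm r)"
  have eq: "star t * t + star r * r = star k * r + star e * t"
    using adjoint_onD [OF adj T] by (simp add: star_simps algebra_simps)
  have "norm (star t * t + star r * r) \<le> norm k * m + norm e * m"
    unfolding eq
    by (intro norm_triangle_mono order.trans [OF norm_mult_ineq]) (auto simp: m_def mult_left_mono)
  then have "m\<^sup>2 \<le> 8 * (norm k * m + norm e * m)"
    using norm_le_sum_star_mult(1) [of t r] norm_le_sum_star_mult(2) [where a = t and b = r]
    by (auto simp: m_def max_def)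
  also have "\<dots> = (8 * (norm k + norm e)) * m" by (simp add: algebra_simps)
  finally have "m \<le> 8 * (norm k + norm e)"
    by (cases "m = 0") (auto simp: power2_eq_square m_def max_def split: if_splits)
  then show "norm t \<le> 8 * (norm k + norm e)" and "norm r \<le> 8 * (norm k + norm e)"
    by (auto simp: m_def)
qed

text \<open>
  The vector \<open>(0, k)\<close> lies in the sum of the graph of \<open>T\<close> and its orthogonal complement, the
  rotated graph of the adjoint.
\<close>

lemma regular_on_graph_decomposition:
  fixes K :: "'a::cstar_algebra set"
  assumes K: "closed_ideal K" and reg: "regular_on K T" and k: "k \<in> K"
  obtains t r where "(t, r) \<in> T" "(k - r, t) \<in> adjoint_on K T"
proof -
  have op: "operator_on K T" and cl: "closed T"
    and dd: "K \<subseteq> closure (Domain (adjoint_on K T))"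
    and rg: "K \<subseteq> closure {x + z | x z. (x, z) \<in> T O adjoint_on K T}"
    using reg by (auto simp: regular_on_def densely_defined_def dense_in_def)
  have closedK: "closed K" using K by (simp add: closed_ideal_def)
  have adj_diff: "(a - c, b - d) \<in> adjoint_on K T"
    if "(a, b) \<in> adjoint_on K T" "(c, d) \<in> adjoint_on K T" for a b c d
    using that adjoint_on_diff [of a b T c d] closed_ideal_diff [OF K]
    by (auto simp: adjoint_on_eq [of K])
  \<comment> \<open>First move \<open>k\<close> to a nearby \<open>k'\<close> in the domain of the
    adjoint, with image \<open>g\<close>; then approximate \<open>g\<close> by \<open>t + s\<close>
    from the range of 1 plus adjoint times \<open>T\<close>. The error is
    \<open>e = t + s - g\<close>.\<close>
  have ex: "\<exists>t r k' e. (t, r) \<in> T \<and> (k' - r, t - e) \<in> adjoint_on K T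
      \<and> norm (k' - k) < \<epsilon> \<and> norm e < \<epsilon>"
    if \<epsilon>: "\<epsilon> > 0" for \<epsilon>
  proof -
    obtain k' g where kg: "(k', g) \<in> adjoint_on K T" "norm (k' - k) < \<epsilon>"
      using dd k \<epsilon> unfolding closure_approachable subset_iff dist_norm by blast
    then have "g \<in> K" by (auto simp: adjoint_on_def)
    then obtain t r s where "(t, r) \<in> T" "(r, s) \<in> adjoint_on K T" "norm (t + s - g) < \<epsilon>"
      using rg \<epsilon> unfolding closure_approachable subset_iff dist_norm by blast
    moreover have "g - s = t - (t + s - g)" by simp
    ultimately show ?thesis using adj_diff [OF kg(1)] kg(2) by metis
  qed
  have "\<forall>n. \<exists>t r k' e. (t, r) \<in> T \<and> (k' - r, t - e) \<in> adjoint_on K T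
      \<and> norm (k' - k) < inverse (Suc n) \<and> norm e < inverse (Suc n)"
    by (intro allI ex) simp
  then obtain t r k' e where
    T: "\<And>n. (t n, r n) \<in> T" and adj: "\<And>n. (k' n - r n, t n - e n) \<in> adjoint_on K T"
    and kn: "\<And>n. norm (k' n - k) < inverse (Suc n)" and en: "\<And>n. norm (e n) < inverse (Suc n)"
    by metis
  have k_lim: "k' \<longlonglongrightarrow> k"
    by (rule LIM_zero_cancel, rule Lim_null_comparison [OF _ LIMSEQ_inverse_real_of_nat])
      (use kn in \<open>auto intro: always_eventually less_imp_le\<close>)
  have e_lim: "e \<longlonglongrightarrow> 0"
    by (rule Lim_null_comparison [OF _ LIMSEQ_inverse_real_of_nat])
      (use en in \<open>auto intro: always_eventually less_imp_le\<close>)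
  \<comment> \<open>Differences of approximate splittings are again such splittings, so the
    Lipschitz bound makes \<open>t\<close> and \<open>r\<close> Cauchy.\<close>
  have bound: "norm (t m - t n) \<le> 8 * (norm (k' m - k' n) + norm (e m - e n))
      \<and> norm (r m - r n) \<le> 8 * (norm (k' m - k' n) + norm (e m - e n))" for m n
  proof -
    have "(k' m - r m - (k' n - r n), t m - e m - (t n - e n)) \<in> adjoint_on UNIV T"
      using adjoint_on_diff adj by (metis IntD2 adjoint_on_eq)
    then have "(k' m - k' n - (r m - r n), t m - t n - (e m - e n)) \<in> adjoint_on UNIV T"
      by (simp add: algebra_simps)
    with graph_norm_bound [OF operator_on_diff [OF op T T]] show ?thesis by blast
  qed
  have "Cauchy X" if X: "\<And>m n. norm (X m - X n) \<le> 8 * (norm (k' m - k' n) + norm (e m - e n))"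
    for X :: "nat \<Rightarrow> 'a"
  proof (rule CauchyI)
    fix \<epsilon> :: real assume \<epsilon>: "\<epsilon> > 0"
    obtain N1 where N1: "\<And>m n. m \<ge> N1 \<Longrightarrow> n \<ge> N1 \<Longrightarrow> norm (k' m - k' n) < \<epsilon> / 16"
      using CauchyD [OF LIMSEQ_imp_Cauchy [OF k_lim], of "\<epsilon> / 16"] \<epsilon> by auto
    obtain N2 where N2: "\<And>m n. m \<ge> N2 \<Longrightarrow> n \<ge> N2 \<Longrightarrow> norm (e m - e n) < \<epsilon> / 16"
      using CauchyD [OF LIMSEQ_imp_Cauchy [OF e_lim], of "\<epsilon> / 16"] \<epsilon> by auto
    have "norm (X m - X n) < \<epsilon>" if "m \<ge> max N1 N2" "n \<ge> max N1 N2" for m n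
      using X [of m n] N1 [of m n] N2 [of m n] that by simp
    then show "\<exists>M. \<forall>m\<ge>M. \<forall>n\<ge>M. norm (X m - X n) < \<epsilon>" by blast
  qed
  then obtain t' r' where lim: "t \<longlonglongrightarrow> t'" "r \<longlonglongrightarrow> r'"
    using bound Cauchy_convergent unfolding convergent_def by metis
  have "(t', r') \<in> T"
    using closed_sequentially [OF cl T tendsto_Pair [OF lim]] .
  moreover have "closed (adjoint_on K T)"
    by (subst adjoint_on_eq) (intro closed_Int closed_Times closedK closed_adjoint_on)
  then have "(k - r', t' - 0) \<in> adjoint_on K T"
    by (rule closed_sequentially [where f = "\<lambda>n. (k' n - r n, t n - e n)"])
      (intro adj tendsto_Pair tendsto_diff k_lim e_lim lim)+
  ultimately show thesis using that by simp
qed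

section \<open>Semiregular operators and their restrictions\<close>

text \<open>Semiregularity directly gives only that \<open>x * c\<close> is in the domain. Its image
  and \<open>y * c\<close> have the same inner product with every element of the dense domain of the
  adjoint, so they agree.\<close>

lemma semiregular_on_mult_right:
  fixes S :: "('a::cstar_algebra \<times> 'a) set"
  assumes S: "semiregular_on UNIV S" and xy: "(x, y) \<in> S"
  shows "(x * c, y * c) \<in> S"
proof -
  obtain z where z: "(x * c, z) \<in> S"
    using S xy unfolding semiregular_on_def by (meson DomainE Domain.DomainI UNIV_I)
  have "closure (Domain (adjoint_on UNIV S)) = UNIV"
    using S by (auto simp: semiregular_on_def densely_defined_def dense_in_def)
  moreover have "star a * (z - y * c) = 0" if "a \<in> Domain (adjoint_on UNIV S)" for a
  proof -
    obtain b where "(a, b) \<in> adjoint_on UNIV S" using \<open>a \<in> _\<close> by blast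
    from adjoint_onD [OF this z] adjoint_onD [OF this xy] show ?thesis
      by (simp add: algebra_simps) (simp flip: mult.assoc)
  qed
  ultimately have "z - y * c = 0" by (rule mult_eq_0_if_closure)
  with z show ?thesis by simp
qed

text \<open>Right multiplication by elements of \<open>K\<close> moves the graph of \<open>S\<close>
  into that of the restriction. The defect \<open>star a * y - star b * x\<close> thus annihilates
  \<open>K\<close>, and essentiality makes it zero.\<close>

lemma adjoint_on_restrict_op_subset:
  fixes K :: "'a::cstar_algebra set"
  assumes K: "essential_ideal K" and S: "semiregular_on UNIV S"
  shows "adjoint_on K (restrict_op S K) \<subseteq> adjoint_on UNIV S"
proof
  fix c assume c: "c \<in> adjoint_on K (restrict_op S K)"
  obtain a b where ab: "c = (a, b)" by fastforce
  have "star a * y - star b * x = 0" if xy: "(x, y) \<in> S" for x y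
  proof (rule essential_ideal_annihilator [OF K])
    fix k assume "k \<in> K"
    then have "x * k \<in> K" using K by (auto simp: essential_ideal_def closed_ideal_def)
    then have "(x * k, y * k) \<in> restrict_op S K"
      using semiregular_on_mult_right [OF S xy] by (simp add: restrict_op_def)
    from adjoint_onD [OF c [unfolded ab] this]
    show "(star a * y - star b * x) * k = 0" by (simp add: algebra_simps)
  qed
  then show "c \<in> adjoint_on UNIV S" by (auto simp: ab intro!: adjoint_onI)
qed

section \<open>Density of the range and regularity of the biadjoint\<close>

lemma subspace_closure:
  fixes F :: "'a::real_normed_vector set"
  assumes "subspace F"
  shows "subspace (closure F)"
proof (rule subspaceI)
  show "0 \<in> closure F" using assms closure_subset subspace_0 by blast
  show "x + y \<in> closure F" if xy: "x \<in> closure F" "y \<in> closure F" for x y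
  proof -
    obtain f g where "\<And>n. f n \<in> F" "f \<longlonglongrightarrow> x" "\<And>n. g n \<in> F" "g \<longlonglongrightarrow> y"
      using xy unfolding closure_sequential by blast
    then show ?thesis
      unfolding closure_sequential using subspace_add [OF assms]
      by (intro exI [of _ "\<lambda>n. f n + g n"]) (auto intro: tendsto_add)
  qed
  show "c *\<^sub>R x \<in> closure F" if "x \<in> closure F" for c x
  proof -
    have "(*\<^sub>R) c ` closure F \<subseteq> closure F"
      by (rule image_closure_subset)
        (use subspace_scale [OF assms] closure_subset [of F] in \<open>auto intro!: continuous_intros\<close>)
    with that show ?thesis by blast
  qed
qed

theorem corollary3p2:
  fixes K :: "'a::cstar_algebra set" and S :: "('a \<times> 'a) set"
  assumes "separable_space (euclidean :: 'a topology)"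
    and "\<not> unital TYPE('a)"
    and "essential_ideal K"
    and "semiregular_on UNIV S" and "closed S"
    and "regular_on K (restrict_op S K)"
    and "abelian_quotient K"
  shows "regular_on UNIV (adjoint_on UNIV (adjoint_on UNIV S))"
proof -
  define A where "A = adjoint_on UNIV S"
  define W where "W = adjoint_on UNIV A"
  define F where "F = {x + z | x z. (x, z) \<in> S O A}"
  define I where "I = closure F"
  have K: "closed_ideal K" using assms(3) by (simp add: essential_ideal_def)
  have S: "operator_on UNIV S" and dS: "closure (Domain S) = UNIV" and dA: "closure (Domain A) = UNIV"
    using assms(4) by (auto simp: semiregular_on_def densely_defined_def dense_in_def A_def)
  note S_right = semiregular_on_mult_right [OF assms(4)]
  have A: "operator_on UNIV A" unfolding A_def by (rule operator_on_adjoint_on [OF dS])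
  have A_right: "(a * m, b * m) \<in> A" if "(a, b) \<in> A" for a b m
    using that adjoint_on_mult_right unfolding A_def by blast
  have SW: "S \<subseteq> W" and AW: "A \<subseteq> adjoint_on UNIV W"
    unfolding W_def A_def by (rule subset_adjoint_adjoint)+
  have adjK: "adjoint_on K (restrict_op S K) \<subseteq> A"
    unfolding A_def by (rule adjoint_on_restrict_op_subset [OF assms(3,4)])
  have restr: "restrict_op S K \<subseteq> S" by (auto simp: restrict_op_def)

  have FI: "x + z \<in> F" if "(x, y) \<in> S" "(y, z) \<in> A" for x y z
    unfolding F_def using that by blast
  have "subspace F"
  proof (rule subspaceI)
    have "(0, 0) \<in> S" "(0, 0) \<in> A" using S A by (auto simp: operator_on_def)
    then show "0 \<in> F" unfolding F_def by force
  next
    fix u v assume "u \<in> F" "v \<in> F"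
    then obtain x y z x' y' z' where "u = x + z" "(x, y) \<in> S" "(y, z) \<in> A"
      "v = x' + z'" "(x', y') \<in> S" "(y', z') \<in> A"
      unfolding F_def by blast
    moreover from this have "(x + x', y + y') \<in> S" "(y + y', z + z') \<in> A"
      using S A unfolding operator_on_def by blast+
    moreover from calculation have "u + v = (x + x') + (z + z')" by simp
    ultimately show "u + v \<in> F" unfolding F_def by blast
  next
    fix c :: real and u assume "u \<in> F"
    then obtain x y z where "u = x + z" "(x, y) \<in> S" "(y, z) \<in> A"
      unfolding F_def by blast
    moreover from this have "(c *\<^sub>R x, c *\<^sub>R y) \<in> S" "(c *\<^sub>R y, c *\<^sub>R z) \<in> A"
      using S A operator_on_scaleR by blast+
    ultimately show "c *\<^sub>R u \<in> F" unfolding F_def using scaleR_add_right by blast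
  qed
  then have I: "closed I" "subspace I" by (auto simp: I_def subspace_closure)
  have I_right: "u * m \<in> I" if "u \<in> I" for u m
  proof -
    have "(\<lambda>u. u * m) ` closure F \<subseteq> closure F"
    proof (rule image_closure_subset)
      have "u * m \<in> F" if u: "u \<in> F" for u
      proof -
        obtain x y z where "u = x + z" "(x, y) \<in> S" "(y, z) \<in> A"
          using u unfolding F_def by blast
        then have "u * m = x * m + z * m" "(x * m, y * m) \<in> S" "(y * m, z * m) \<in> A"
          using S_right A_right by (simp_all add: distrib_right)
        then show ?thesis unfolding F_def by blast
      qed
      then show "(\<lambda>u. u * m) ` F \<subseteq> closure F" using closure_subset by blast
    qed (auto intro!: continuous_intros)
    with that show ?thesis by (auto simp: I_def)
  qed
  have "K \<subseteq> closure {x + z | x z. (x, z) \<in> restrict_op S K O adjoint_on K (restrict_op S K)}"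
    using assms(6) by (simp add: regular_on_def dense_in_def)
  also have "\<dots> \<subseteq> I"
    unfolding I_def F_def by (rule closure_mono) (use restr adjK in blast)
  finally have KI: "K \<subseteq> I" .
  have comm: "a * b - b * a \<in> I" for a b
    using abelian_quotient_commutator [OF K assms(7)] KI by blast
  have I_left: "m * u \<in> I" if "u \<in> I" for u m
    using subspace_add [OF I(2) comm [of m u] I_right [OF that, of m]] by simp

  have hI: "(star w * w + star p * p) * x \<in> I" if wp: "(w, p) \<in> S" for w p x
  proof -
    have gen: "(star w * w + star p * p) * v \<in> I" if vq: "(v, q) \<in> A" for v q
    proof -
      define k where "k = p * star w * v - v * (p * star w)"
      have "k \<in> K" unfolding k_def by (rule abelian_quotient_commutator [OF K assms(7)])
      then obtain t r where "(t, r) \<in> restrict_op S K"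
        "(k - r, t) \<in> adjoint_on K (restrict_op S K)"
        by (rule regular_on_graph_decomposition [OF K assms(6)])
      then have tr: "(t, r) \<in> S" "(k - r, t) \<in> A"
        by (auto dest: restr [THEN subsetD] adjK [THEN subsetD])
      \<comment> \<open>After this correction the image of the first element is
        \<open>v * (p * star w) + (k - r)\<close>, which lies in the domain of \<open>A\<close>; the
        two occurrences of \<open>t\<close> cancel in the sum.\<close>
      have "(w * (star w * v) - t, p * (star w * v) - r) \<in> S"
        using operator_on_diff [OF S S_right [OF wp] tr(1)] .
      moreover have "(v * (p * star w) + (k - r), q * (p * star w) + t) \<in> A"
        unfolding A_def
        by (intro adjoint_on_add; fold A_def) (rule A_right [OF vq], rule tr(2))
      moreover have "v * (p * star w) + (k - r) = p * (star w * v) - r"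
        by (simp add: k_def mult.assoc)
      ultimately have "(w * (star w * v) - t) + (q * (p * star w) + t) \<in> F"
        by (intro FI) simp_all
      then have "w * star w * v + q * (p * star w) \<in> F" by (simp add: mult.assoc)
      then have 1: "w * star w * v + q * (p * star w) \<in> I"
        unfolding I_def using closure_subset by blast
      have rel: "star w * q = star p * v"
      proof -
        have "star (star v * p) = star (star q * w)"
          using adjoint_onD [of v q UNIV S w p] vq wp by (simp add: A_def)
        then show ?thesis by (simp add: star_simps)
      qed
      \<comment> \<open>Modulo \<open>I\<close> factors may be permuted, and \<open>rel\<close>
        trades \<open>star w * q\<close> for \<open>star p * v\<close>, eliminating
        \<open>q\<close>.\<close>
      have c: "(star w * w - w * star w) * v \<in> I" "q * (p * star w) - p * star w * q \<in> I"
        "(star p * p - p * star p) * v \<in> I"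
        using comm I_right by blast+
      have "p * star w * q = p * star p * v" using rel by (simp add: mult.assoc)
      then have "(star w * w + star p * p) * v = w * star w * v + q * (p * star w)
          + (star w * w - w * star w) * v - (q * (p * star w) - p * star w * q)
          + (star p * p - p * star p) * v"
        by (simp add: algebra_simps)
      also have "\<dots> \<in> I"
        by (rule subspace_add [OF I(2) subspace_diff [OF I(2) subspace_add [OF I(2) 1 c(1)] c(2)] c(3)])
      finally show ?thesis .
    qed
    \<comment> \<open>The condition on \<open>v\<close> is closed, so it passes from the dense
      domain of \<open>A\<close> to the whole algebra.\<close>
    have "(\<lambda>v. (star w * w + star p * p) * v) ` closure (Domain A) \<subseteq> I"
      by (rule image_closure_subset) (use gen I in \<open>auto intro!: continuous_intros\<close>)
    then show ?thesis by (auto simp: dA)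
  qed
  have "Domain S \<subseteq> I"
    using mem_ideal_if_sum_star_mult [OF I I_left hI] by blast
  then have "I = UNIV" using dS I(1) closure_minimal by blast
  moreover have "F \<subseteq> {x + z | x z. (x, z) \<in> W O adjoint_on UNIV W}"
    unfolding F_def using SW AW by blast
  ultimately have "closure {x + z | x z. (x, z) \<in> W O adjoint_on UNIV W} = UNIV"
    unfolding I_def using closure_mono by blast
  moreover have "closure (Domain W) = UNIV" "closure (Domain (adjoint_on UNIV W)) = UNIV"
    using dS dA closure_mono [OF Domain_mono [OF SW]] closure_mono [OF Domain_mono [OF AW]] by auto
  moreover have "operator_on UNIV W" "closed W"
    unfolding W_def by (rule operator_on_adjoint_on [OF dA]) (rule closed_adjoint_on)
  ultimately show ?thesis
    by (simp add: regular_on_def densely_defined_def dense_in_def W_def A_def)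
qed

end
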